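(* Let $n,d\ge1$ be integers with $nd\ge2$, $\lambda\in(0,1)$, $K_n\in[n]$, $K_d\in[d]$. Assume that for some $\bar c\ge10$, $$\max\left\{\lambda,\ \lambda\frac{K_d}{\sqrt d},\ \lambda\frac{K_n}{\sqrt n},\ \lambda\frac{K_nK_d}{\sqrt{nd}}\right\}\le 2^{-2-2\bar c}\,(\log(nd))^{-1/2}.$$ Then $$\inf_{f\in\mathcal P_{\le 2^{2\bar c}\log(nd)}}\ \sup_{M\in\mathcal H(\lambda,K_n,K_d)\cup\{M_0\}}\mathbb E_M[(f-x_0)^2]\ \ge\ \frac14\left[1-2^{-\bar c}\right].$$
   Context: For $M\in[0,1]^{n\times d}$, $\mathbb E_M$ denotes expectation under the law where $Y\in\{-1,1\}^{n\times d}$ has independent entries with $\mathbb P_M[Y_{i,k}=1]=(1+M_{i,k})/2$. $M_0$ is the zero $n\times d$ matrix and $x_0=x_0(M)=\mathbf 1\{M\ne M_0\}$. $\mathcal H(\lambda,K_n,K_d)$ is the set of matrices $\lambda\mathbf 1\{S\times T\}$ (entry $\lambda$ on $S\times T$, zero elsewhere) with $S\subset[n]$, $|S|=K_n$, $T\subset[d]$, $|T|=K_d$. For a real number $D\ge 0$, $\mathcal P_{\le D}$ is the set of real polynomials of degree at most $D$ in the entries of $Y$; $f$ stands for $f(Y)$. *)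

theory Defs
  imports "HOL-Probability.Probability" "HOL-Library.Poly_Mapping"
begin

text \<open>
  An \<open>n \<times> d\<close> matrix has type \<^typ>\<open>real ^ 'd ^ 'n\<close>, with \<open>n = CARD('n)\<close> and \<open>d = CARD('d)\<close>.
\<close>

definition entry_law :: "real \<Rightarrow> real pmf" where
  "entry_law m = map_pmf (\<lambda>b. if b then 1 else - 1) (bernoulli_pmf ((1 + m) / 2))"

text \<open>The default value \<open>0\<close> of \<^const>\<open>Pi_pmf\<close> plays no role, the index set being \<^term>\<open>UNIV\<close>.\<close>

definition obs_law :: "real ^ 'd ^ 'n \<Rightarrow> (real ^ 'd ^ 'n) pmf" where
  "obs_law M = map_pmf (\<lambda>y. \<chi> i k. y (i, k)) (Pi_pmf UNIV 0 (\<lambda>(i, k). entry_law (M $ i $ k)))"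

definition planted :: "real \<Rightarrow> nat \<Rightarrow> nat \<Rightarrow> (real ^ 'd ^ 'n) set" where
  "planted lam Kn Kd =
     {(\<chi> i k. if i \<in> S \<and> k \<in> T then lam else 0) | S T. card S = Kn \<and> card T = Kd}"

text \<open>
  Real polynomials in the entries of an \<open>n \<times> d\<close> matrix: finitely supported maps from monomials
  to coefficients, a monomial being a finitely supported map from entry positions to exponents.
\<close>

type_synonym ('n, 'd) entry_poly = "('n \<times> 'd \<Rightarrow>\<^sub>0 nat) \<Rightarrow>\<^sub>0 real"

definition monom_degree :: "('n \<times> 'd \<Rightarrow>\<^sub>0 nat) \<Rightarrow> nat" where
  "monom_degree m = (\<Sum>v\<in>Poly_Mapping.keys m. Poly_Mapping.lookup m v)"

text \<open>The zero polynomial gets degree \<open>0\<close>.\<close>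

definition total_degree :: "('n, 'd) entry_poly \<Rightarrow> nat" where
  "total_degree p = Max (insert 0 (monom_degree ` Poly_Mapping.keys p))"

definition poly_eval :: "('n, 'd) entry_poly \<Rightarrow> real ^ 'd ^ 'n \<Rightarrow> real" where
  "poly_eval p Y =
     (\<Sum>m\<in>Poly_Mapping.keys p. Poly_Mapping.lookup p m *
        (\<Prod>(i, k)\<in>Poly_Mapping.keys m. (Y $ i $ k) ^ Poly_Mapping.lookup m (i, k)))"

definition polys_le :: "real \<Rightarrow> (real ^ 'd ^ 'n \<Rightarrow> real) set" where
  "polys_le D = {poly_eval p | p. real (total_degree p) \<le> D}"

definition sq_risk :: "(real ^ 'd ^ 'n \<Rightarrow> real) \<Rightarrow> real ^ 'd ^ 'n \<Rightarrow> real" where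
  "sq_risk f M = measure_pmf.expectation (obs_law M) (\<lambda>Y. (f Y - of_bool (M \<noteq> 0))\<^sup>2)"

text \<open>
  Infima and suprema of reals are only meaningful for nonempty bounded sets; the following facts
  show that the minimax risk over \<^const>\<open>polys_le\<close> and \<^const>\<open>planted\<close> is a genuine one.
\<close>

lemma finite_planted: "finite (planted lam Kn Kd :: (real ^ 'd ^ 'n) set)"
proof -
  have "planted lam Kn Kd \<subseteq> (\<lambda>(S, T). (\<chi> i k. if i \<in> S \<and> k \<in> T then lam else 0) :: real ^ 'd ^ 'n) ` UNIV"
    unfolding planted_def by auto
  then show ?thesis by (rule finite_subset) simp
qed

lemma bdd_above_sq_risk: "bdd_above (sq_risk f ` (planted lam Kn Kd \<union> {0}))"
  by (intro bdd_above_finite) (simp add: finite_planted)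

lemma polys_le_nonempty: "0 \<le> D \<Longrightarrow> polys_le D \<noteq> {}"
  unfolding polys_le_def by (auto intro!: exI[of _ 0] simp: total_degree_def)

lemma bdd_below_sup_sq_risk:
  "bdd_below ((\<lambda>f. SUP M\<in>planted lam Kn Kd \<union> {0}. sq_risk f M) ` F)"
proof (rule bdd_belowI2)
  fix f :: "real ^ 'd ^ 'n \<Rightarrow> real"
  have "0 \<le> sq_risk f 0"
    by (simp add: sq_risk_def)
  also have "\<dots> \<le> (SUP M\<in>planted lam Kn Kd \<union> {0}. sq_risk f M)"
    by (rule cSUP_upper[OF _ bdd_above_sq_risk]) simp
  finally show "0 \<le> (SUP M\<in>planted lam Kn Kd \<union> {0}. sq_risk f M)" .
qed

end

theory Submission
  imports Defs
begin

text \<open>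
  The supremum is at least the average of the risk at \<open>0\<close> and the mean risk over uniformly chosen
  blocks \<open>S \<times> T\<close>, so it suffices to bound this Bayes risk. On matrices with entries \<open>\<plusminus>1\<close> a
  polynomial of degree at most \<open>D\<close> is a combination \<open>f = (\<Sum>A. c A * walsh A)\<close> of Walsh functions,
  the products of the entries over sets \<open>A\<close> of at most \<open>D\<close> positions. These are orthonormal under
  the null law, so the null risk is \<open>\<Sum>A. (c A)\<^sup>2\<close>. Under the prior the mean of \<open>f\<close> is
  \<open>\<Sum>A. c A * v A\<close>, where \<open>v A\<close> is the mean of \<open>walsh A\<close>. From \<open>(f - 1)\<^sup>2 \<ge> 3/4 - f\<close> and
  \<open>c\<^sup>2 - c v \<ge> - v\<^sup>2/4\<close> the sum of the two risks is at least \<open>3/4 - (\<Sum>A. (v A)\<^sup>2)/4\<close>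
  (\<open>average_risk_lower_bound\<close>). The empty set contributes \<open>1\<close> to the last sum, which leaves
  \<open>1/2 - \<epsilon>/4\<close>, where \<open>\<epsilon>\<close> collects the nonempty sets; what remains is to see that \<open>\<epsilon>\<close> is small.

  Regard \<open>A\<close> as the edge set of a bipartite graph between rows and columns. If it has \<open>e\<close> edges
  and meets \<open>r\<close> rows and \<open>c\<close> columns, then \<open>(v A)\<^sup>2\<close> is at most
  \<open>\<lambda>\<^bsup>2e\<^esup> (K\<^sub>n/n)\<^bsup>2r\<^esup> (K\<^sub>d/d)\<^bsup>2c\<^esup>\<close> (\<open>average_block_moment_le\<close>). Let \<open>U e\<close> be the sum of
  these weights over all graphs with \<open>e\<close> edges. Build a graph edge by edge: the row of the next edge
  is one of at most \<open>e\<close> old ones, or one of at most \<open>n\<close> new ones at the price \<open>(K\<^sub>n/n)\<^sup>2\<close>, which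
  gives a factor at most \<open>(e + 1) max {1, K\<^sub>n\<^sup>2/n}\<close>; columns are similar. A graph with \<open>e + 1\<close>
  edges arises in \<open>e + 1\<close> ways, so \<open>U (e + 1) \<le> (e + 1) \<eta> U e\<close> with
  \<open>\<eta> = \<lambda>\<^sup>2 max {1, K\<^sub>n\<^sup>2/n} max {1, K\<^sub>d\<^sup>2/d}\<close> (\<open>sum_edge_weight_Suc_le\<close>), and the four quantities in
  the hypothesis of the theorem are the square roots of the four products that \<open>\<eta>\<close> can be. Hence
  \<open>U e \<le> e! \<eta>\<^sup>e \<le> (D \<eta>)\<^sup>e\<close> for \<open>e \<le> D\<close>, and \<open>\<epsilon>\<close> is bounded by a geometric series of ratio
  \<open>D \<eta> \<le> 2 powr (- 4 - 2 * cbar)\<close>, which gives \<open>\<epsilon> \<le> 2 powr (- cbar)\<close>.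
\<close>

section \<open>Walsh functions of a sign matrix\<close>

definition sign_matrix :: "real ^ 'd ^ 'n \<Rightarrow> bool" where
  "sign_matrix Y \<longleftrightarrow> (\<forall>i k. Y $ i $ k \<in> {1, - 1})"

definition walsh :: "('n \<times> 'd) set \<Rightarrow> real ^ 'd ^ 'n \<Rightarrow> real" where
  "walsh A Y = (\<Prod>a\<in>A. Y $ fst a $ snd a)"

lemma set_entry_law: "set_pmf (entry_law m) \<subseteq> {1, - 1}"
  unfolding entry_law_def by auto

lemma finite_set_pmf_obs_law: "finite (set_pmf (obs_law (M :: real ^ 'd::finite ^ 'n::finite)))"
proof -
  have "finite (set_pmf (entry_law m))" for m
    using set_entry_law by (rule finite_subset) simp
  then have "finite (PiE_dflt UNIV 0 (set_pmf \<circ> (\<lambda>(i, k). entry_law (M $ i $ k))))"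
    by (intro finite_PiE_dflt) auto
  then show ?thesis
    unfolding obs_law_def by (simp add: set_Pi_pmf)
qed

lemma sign_matrix_obs_law:
  assumes "Y \<in> set_pmf (obs_law (M :: real ^ 'd::finite ^ 'n::finite))"
  shows "sign_matrix Y"
proof -
  obtain y where y: "Y = (\<chi> i k. y (i, k))"
    "y \<in> PiE_dflt UNIV 0 (set_pmf \<circ> (\<lambda>(i, k). entry_law (M $ i $ k)))"
    using assms unfolding obs_law_def by (auto simp: set_Pi_pmf)
  have "y (i, k) \<in> {1, - 1}" for i k
    using y(2) set_entry_law[of "M $ i $ k"] by (force simp: PiE_dflt_def)
  then show ?thesis
    by (simp add: sign_matrix_def y(1))
qed

lemma integrable_obs_law [simp]:
  "integrable (measure_pmf (obs_law (M :: real ^ 'd::finite ^ 'n::finite))) (f :: _ \<Rightarrow> real)"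
  by (intro integrable_measure_pmf_finite finite_set_pmf_obs_law)

lemma expectation_entry_law:
  assumes "\<bar>m\<bar> \<le> 1"
  shows "measure_pmf.expectation (entry_law m) (\<lambda>y. y) = m"
proof -
  have "0 \<le> (1 + m) / 2" "(1 + m) / 2 \<le> 1"
    using assms by auto
  then show ?thesis
    unfolding entry_law_def by (simp add: field_simps)
qed

lemma expectation_walsh:
  fixes M :: "real ^ 'd::finite ^ 'n::finite"
  assumes "\<And>i k. \<bar>M $ i $ k\<bar> \<le> 1"
  shows "measure_pmf.expectation (obs_law M) (walsh A) = (\<Prod>a\<in>A. M $ fst a $ snd a)"
proof -
  define p where "p = (\<lambda>(i, k). entry_law (M $ i $ k))"
  define P where "P = Pi_pmf (UNIV :: ('n \<times> 'd) set) 0 p"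
  have fin: "finite (set_pmf P)"
    using set_entry_law unfolding P_def
    by (subst set_Pi_pmf) (auto intro!: finite_PiE_dflt finite_subset[OF set_entry_law] simp: p_def)
  have "prob_space.indep_vars (measure_pmf P) (\<lambda>_. borel) (\<lambda>a y. y a) A"
    unfolding P_def
    by (rule prob_space.indep_vars_compose2[OF measure_pmf.prob_space_axioms
          prob_space.indep_vars_subset[OF measure_pmf.prob_space_axioms indep_vars_Pi_pmf]]) auto
  then have "measure_pmf.expectation P (\<lambda>y. \<Prod>a\<in>A. y a) =
      (\<Prod>a\<in>A. measure_pmf.expectation P (\<lambda>y. y a))"
    by (intro prob_space.indep_vars_lebesgue_integral measure_pmf.prob_space_axioms
        integrable_measure_pmf_finite[OF fin]) auto
  also have "\<dots> = (\<Prod>a\<in>A. M $ fst a $ snd a)"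
  proof (intro prod.cong refl)
    fix a
    have "measure_pmf.expectation P (\<lambda>y. y a) =
        measure_pmf.expectation (map_pmf (\<lambda>y. y a) P) (\<lambda>y. y)"
      by simp
    also have "map_pmf (\<lambda>y. y a) P = p a"
      unfolding P_def by (rule Pi_pmf_component[THEN trans]) auto
    finally show "measure_pmf.expectation P (\<lambda>y. y a) = M $ fst a $ snd a"
      using expectation_entry_law[OF assms] by (simp add: p_def split: prod.split)
  qed
  finally show ?thesis
    unfolding obs_law_def p_def[symmetric] P_def[symmetric] walsh_def by simp
qed

text \<open>The common entries cancel, since their squares are \<open>1\<close>.\<close>

lemma walsh_mult_walsh:
  fixes Y :: "real ^ 'd::finite ^ 'n::finite"
  assumes "sign_matrix Y"
  shows "walsh A Y * walsh B Y = walsh ((A - B) \<union> (B - A)) Y"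
proof -
  have sq: "walsh (A \<inter> B) Y * walsh (A \<inter> B) Y = 1"
    unfolding walsh_def prod.distrib[symmetric]
  proof (intro prod.neutral ballI)
    fix a
    show "Y $ fst a $ snd a * Y $ fst a $ snd a = 1"
      using assms[unfolded sign_matrix_def, rule_format, of "fst a" "snd a"] by auto
  qed
  have split: "walsh C Y = walsh (C - D) Y * walsh (C \<inter> D) Y" for C D
    unfolding walsh_def by (subst prod.union_disjoint[symmetric]) (auto simp: Un_Diff_Int)
  have "walsh A Y * walsh B Y = walsh (A - B) Y * walsh (B - A) Y * (walsh (A \<inter> B) Y * walsh (A \<inter> B) Y)"
    by (simp add: split[of A B] split[of B A] Int_commute mult_ac)
  also have "\<dots> = walsh (A - B) Y * walsh (B - A) Y"
    by (simp only: sq mult_1_right)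
  also have "\<dots> = walsh ((A - B) \<union> (B - A)) Y"
    unfolding walsh_def by (rule prod.union_disjoint[symmetric]) auto
  finally show ?thesis .
qed

text \<open>
  Parseval's identity: a product of two distinct Walsh functions is a nonconstant one, which has
  mean \<open>0\<close> under the null law.
\<close>

lemma expectation_square_walsh_sum:
  fixes c :: "('n::finite \<times> 'd::finite) set \<Rightarrow> real"
  shows "measure_pmf.expectation (obs_law 0) (\<lambda>Y. (\<Sum>A\<in>F. c A * walsh A Y)\<^sup>2) = (\<Sum>A\<in>F. (c A)\<^sup>2)"
proof -
  have "measure_pmf.expectation (obs_law 0) (\<lambda>Y. (\<Sum>A\<in>F. c A * walsh A Y)\<^sup>2) =
      measure_pmf.expectation (obs_law 0)
        (\<lambda>Y. \<Sum>A\<in>F. \<Sum>B\<in>F. c A * c B * walsh ((A - B) \<union> (B - A)) Y)"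
  proof (rule integral_cong_AE)
    show "AE Y in obs_law 0. (\<Sum>A\<in>F. c A * walsh A Y)\<^sup>2 =
        (\<Sum>A\<in>F. \<Sum>B\<in>F. c A * c B * walsh ((A - B) \<union> (B - A)) Y)"
      by (rule AE_pmfI)
        (simp add: power2_eq_square sum_product sign_matrix_obs_law walsh_mult_walsh[symmetric] mult_ac)
  qed auto
  also have "\<dots> = (\<Sum>A\<in>F. \<Sum>B\<in>F. c A * c B * of_bool (A = B))"
  proof -
    have "measure_pmf.expectation (obs_law 0) (walsh ((A - B) \<union> (B - A))) = (of_bool (A = B) :: real)"
      for A B :: "('n \<times> 'd) set"
      by (subst expectation_walsh) auto
    then show ?thesis by simp
  qed
  also have "\<dots> = (\<Sum>A\<in>F. (c A)\<^sup>2)"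
    by (intro sum.cong refl) (simp add: of_bool_def if_distrib sum.delta' power2_eq_square cong: if_cong)
  finally show ?thesis .
qed

text \<open>
  A power of \<open>\<plusminus>1\<close> depends only on the parity of the exponent, so on sign matrices a monomial equals
  the Walsh function of the positions with odd exponent, of which there are at most as many as its
  degree.
\<close>

lemma polys_le_walsh_expansion:
  fixes f :: "real ^ 'd::finite ^ 'n::finite \<Rightarrow> real"
  assumes "f \<in> polys_le D"
  obtains c where "\<And>Y. sign_matrix Y \<Longrightarrow> f Y = (\<Sum>A | real (card A) \<le> D. c A * walsh A Y)"
proof -
  obtain p where f: "f = poly_eval p" and D: "real (total_degree p) \<le> D"
    using assms unfolding polys_le_def by auto
  define odds :: "('n \<times> 'd \<Rightarrow>\<^sub>0 nat) \<Rightarrow> ('n \<times> 'd) set"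
    where "odds m = {a. odd (Poly_Mapping.lookup m a)}" for m
  define c where "c A = (\<Sum>m | m \<in> Poly_Mapping.keys p \<and> odds m = A. Poly_Mapping.lookup p m)" for A
  have odds: "odds m = {a \<in> Poly_Mapping.keys m. odd (Poly_Mapping.lookup m a)}" for m
    by (auto simp: odds_def in_keys_iff odd_pos)
  have card_odds: "real (card (odds m)) \<le> D" if "m \<in> Poly_Mapping.keys p" for m
  proof -
    have "card (odds m) = (\<Sum>a\<in>odds m. 1)" by simp
    also have "\<dots> \<le> (\<Sum>a\<in>odds m. Poly_Mapping.lookup m a)"
      by (intro sum_mono) (auto simp: odds_def Suc_le_eq odd_pos)
    also have "\<dots> \<le> monom_degree m"
      unfolding monom_degree_def by (intro sum_mono2) (auto simp: odds)
    also have "\<dots> \<le> total_degree p"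
      unfolding total_degree_def using that by (intro Max_ge) auto
    finally show ?thesis using D by linarith
  qed
  have "f Y = (\<Sum>A | real (card A) \<le> D. c A * walsh A Y)" if Y: "sign_matrix Y" for Y
  proof -
    have mono: "(\<Prod>(i, k)\<in>Poly_Mapping.keys m. (Y $ i $ k) ^ Poly_Mapping.lookup m (i, k)) =
        walsh (odds m) Y" for m
    proof -
      have "(Y $ i $ k) ^ e = (if odd e then Y $ i $ k else 1)" for i k e
        using Y[unfolded sign_matrix_def, rule_format, of i k] by auto
      then show ?thesis
        unfolding walsh_def odds
        by (simp add: prod.inter_filter case_prod_unfold)
    qed
    have "f Y = (\<Sum>m\<in>Poly_Mapping.keys p. Poly_Mapping.lookup p m * walsh (odds m) Y)"
      unfolding f poly_eval_def mono ..
    also have "\<dots> = (\<Sum>A | real (card A) \<le> D. \<Sum>m | m \<in> Poly_Mapping.keys p \<and> odds m = A.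
        Poly_Mapping.lookup p m * walsh (odds m) Y)"
      by (rule sum.group[symmetric]) (auto simp: card_odds)
    also have "\<dots> = (\<Sum>A | real (card A) \<le> D. c A * walsh A Y)"
      unfolding c_def sum_distrib_right by (intro sum.cong) auto
    finally show ?thesis .
  qed
  then show ?thesis by (rule that)
qed

section \<open>The Bayes risk of a low-degree polynomial\<close>

text \<open>
  The inequality \<open>(f - 1)\<^sup>2 \<ge> 3/4 - f\<close>, that is \<open>(f - 1/2)\<^sup>2 \<ge> 0\<close>, makes the risk under the
  alternative linear in \<open>f\<close>, so that the sum of the two risks can be minimised coefficient by
  coefficient. It is tight at \<open>f = 1/2\<close>, the optimal estimator when the two hypotheses cannot be
  told apart.
\<close>

lemma average_risk_lower_bound:
  fixes f :: "real ^ 'd::finite ^ 'n::finite \<Rightarrow> real" and M :: "'x \<Rightarrow> real ^ 'd ^ 'n"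
  assumes f: "f \<in> polys_le D"
    and P: "finite P" "P \<noteq> {}"
    and M: "\<And>x i k. x \<in> P \<Longrightarrow> \<bar>M x $ i $ k\<bar> \<le> 1" "\<And>x. x \<in> P \<Longrightarrow> M x \<noteq> 0"
  shows "sq_risk f 0 + (\<Sum>x\<in>P. sq_risk f (M x)) / real (card P) \<ge>
    3 / 4 - (\<Sum>A | real (card A) \<le> D.
      ((\<Sum>x\<in>P. \<Prod>a\<in>A. M x $ fst a $ snd a) / real (card P))\<^sup>2) / 4"
proof -
  let ?E = "\<lambda>M. measure_pmf.expectation (obs_law M)"
  let ?F = "{A :: ('n \<times> 'd) set. real (card A) \<le> D}"
  obtain c where c: "\<And>Y. sign_matrix Y \<Longrightarrow> f Y = (\<Sum>A\<in>?F. c A * walsh A Y)"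
    using polys_le_walsh_expansion[OF f] by blast
  define v where "v A = (\<Sum>x\<in>P. \<Prod>a\<in>A. M x $ fst a $ snd a) / real (card P)" for A
  have P': "real (card P) > 0"
    using P by (simp add: card_gt_0_iff)
  have "sq_risk f 0 = ?E 0 (\<lambda>Y. (\<Sum>A\<in>?F. c A * walsh A Y)\<^sup>2)"
    unfolding sq_risk_def
    by (intro integral_cong_AE AE_pmfI) (auto simp: c sign_matrix_obs_law)
  then have null: "sq_risk f 0 = (\<Sum>A\<in>?F. (c A)\<^sup>2)"
    by (simp add: expectation_square_walsh_sum)
  have alt: "sq_risk f (M x) \<ge> 3 / 4 - (\<Sum>A\<in>?F. c A * (\<Prod>a\<in>A. M x $ fst a $ snd a))"
    if x: "x \<in> P" for x
  proof -
    have "3 / 4 - (\<Sum>A\<in>?F. c A * (\<Prod>a\<in>A. M x $ fst a $ snd a)) =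
        ?E (M x) (\<lambda>Y. 3 / 4 - (\<Sum>A\<in>?F. c A * walsh A Y))"
      by (simp add: expectation_walsh M(1)[OF x])
    also have "\<dots> \<le> sq_risk f (M x)"
      unfolding sq_risk_def
    proof (intro integral_mono_AE AE_pmfI integrable_obs_law)
      fix Y assume "Y \<in> set_pmf (obs_law (M x))"
      then have "f Y = (\<Sum>A\<in>?F. c A * walsh A Y)"
        by (intro c sign_matrix_obs_law)
      moreover have "0 \<le> (f Y - 1 / 2)\<^sup>2" by simp
      ultimately show "3 / 4 - (\<Sum>A\<in>?F. c A * walsh A Y) \<le> (f Y - of_bool (M x \<noteq> 0))\<^sup>2"
        using M(2)[OF x] by (simp add: power2_eq_square algebra_simps)
    qed
    finally show ?thesis .
  qed
  have "(\<Sum>x\<in>P. 3 / 4 - (\<Sum>A\<in>?F. c A * (\<Prod>a\<in>A. M x $ fst a $ snd a))) / real (card P) \<le>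
      (\<Sum>x\<in>P. sq_risk f (M x)) / real (card P)"
    by (intro divide_right_mono sum_mono alt) auto
  moreover have "(\<Sum>x\<in>P. 3 / 4 - (\<Sum>A\<in>?F. c A * (\<Prod>a\<in>A. M x $ fst a $ snd a))) / real (card P) =
      3 / 4 - (\<Sum>A\<in>?F. c A * v A)"
  proof -
    have "(\<Sum>x\<in>P. \<Sum>A\<in>?F. c A * (\<Prod>a\<in>A. M x $ fst a $ snd a)) =
        (\<Sum>A\<in>?F. c A * (\<Sum>x\<in>P. \<Prod>a\<in>A. M x $ fst a $ snd a))"
      by (subst sum.swap) (simp add: sum_distrib_left)
    then have "(\<Sum>x\<in>P. \<Sum>A\<in>?F. c A * (\<Prod>a\<in>A. M x $ fst a $ snd a)) / real (card P) =
        (\<Sum>A\<in>?F. c A * v A)"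
      by (simp add: v_def sum_divide_distrib[of _ ?F])
    then show ?thesis
      using P' by (simp add: sum_subtractf diff_divide_distrib)
  qed
  moreover have "(\<Sum>A\<in>?F. (c A)\<^sup>2) - (\<Sum>A\<in>?F. c A * v A) \<ge> - (\<Sum>A\<in>?F. (v A)\<^sup>2) / 4"
  proof -
    have "(\<Sum>A\<in>?F. - (v A)\<^sup>2 / 4) \<le> (\<Sum>A\<in>?F. (c A)\<^sup>2 - c A * v A)"
    proof (rule sum_mono)
      fix A
      have "0 \<le> (c A - v A / 2)\<^sup>2" by simp
      then show "- (v A)\<^sup>2 / 4 \<le> (c A)\<^sup>2 - c A * v A"
        by (simp add: power2_eq_square algebra_simps)
    qed
    then show ?thesis by (simp add: sum_subtractf sum_negf sum_divide_distrib)
  qed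
  ultimately show ?thesis
    unfolding null v_def[symmetric] by linarith
qed

section \<open>Moments of a uniformly chosen block\<close>

text \<open>
  The quotient of the two binomial coefficients is the probability that \<open>r\<close> draws without
  replacement all hit a set of size \<open>K\<close>. Each draw succeeds with probability at most \<open>K / n\<close>, since
  \<open>(K - 1) / (n - 1) \<le> K / n\<close>.
\<close>

lemma binomial_diff_le:
  assumes "r \<le> K" "K \<le> n"
  shows "real ((n - r) choose (K - r)) \<le> (real K / real n) ^ r * real (n choose K)"
  using assms
proof (induction r arbitrary: n K)
  case 0
  then show ?case by simp
next
  case (Suc r)
  then obtain K' n' where K: "K = Suc K'" and n: "n = Suc n'" and le: "r \<le> K'" "K' \<le> n'"
    by (metis Suc_le_D Suc_le_mono)
  have "real ((n - Suc r) choose (K - Suc r)) \<le> (real K' / real n') ^ r * real (n' choose K')"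
    using Suc.IH[OF le] by (simp add: K n)
  also have "\<dots> \<le> (real K / real n) ^ r * real (n' choose K')"
    using le by (intro mult_right_mono power_mono) (auto simp: K n field_simps divide_simps)
  also have "real (n' choose K') = real K / real n * real (n choose K)"
  proof -
    have "real (Suc K') * real (n choose K) = real n * real (n' choose K')"
      using binomial_absorption[of K' n] unfolding K n of_nat_mult[symmetric] diff_Suc_1
      by (rule arg_cong)
    then show ?thesis
      by (simp add: K n divide_simps mult.commute del: binomial_Suc_Suc of_nat_Suc)
  qed
  finally show ?case by (simp add: mult_ac)
qed

lemma card_supersets_le:
  fixes R :: "'a::finite set"
  assumes "K \<le> CARD('a)"
  shows "real (card {S. card S = K \<and> R \<subseteq> S}) \<le>
    (real K / real CARD('a)) ^ card R * real (CARD('a) choose K)"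
proof (cases "card R \<le> K")
  case True
  have "bij_betw (\<lambda>S. S - R) {S. card S = K \<and> R \<subseteq> S} {B. B \<subseteq> - R \<and> card B = K - card R}"
    by (rule bij_betw_byWitness[of _ "\<lambda>B. B \<union> R"])
      (use True in \<open>auto simp: card_Diff_subset intro!: card_Un_disjoint[THEN trans]\<close>)
  then have "card {S. card S = K \<and> R \<subseteq> S} = card {B. B \<subseteq> - R \<and> card B = K - card R}"
    by (rule bij_betw_same_card)
  also have "\<dots> = (CARD('a) - card R) choose (K - card R)"
    by (simp add: n_subsets Compl_eq_Diff_UNIV card_Diff_subset)
  finally show ?thesis
    using binomial_diff_le[OF True assms] by simp
next
  case False
  then have empty: "{S. card S = K \<and> R \<subseteq> S} = {}"
    by (auto dest: card_mono[rotated])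
  show ?thesis unfolding empty by simp
qed

text \<open>
  The set \<open>A\<close> is read as the edges of a bipartite graph: each edge costs \<open>l\<close>, each row that carries
  an edge \<open>p\<close>, and each column that carries one \<open>q\<close>.
\<close>

definition edge_weight :: "real \<Rightarrow> real \<Rightarrow> real \<Rightarrow> ('n \<times> 'd) set \<Rightarrow> real" where
  "edge_weight l p q A = l ^ card A * p ^ card (fst ` A) * q ^ card (snd ` A)"

definition block :: "real \<Rightarrow> 'n set \<times> 'd set \<Rightarrow> real ^ 'd ^ 'n" where
  "block lam = (\<lambda>(S, T). \<chi> i k. if i \<in> S \<and> k \<in> T then lam else 0)"

text \<open>
  The product over \<open>A\<close> is nonzero only if \<open>S\<close> contains the rows and \<open>T\<close> the columns of \<open>A\<close>; as \<open>S\<close>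
  and \<open>T\<close> are independent, the two probabilities multiply.
\<close>

lemma average_block_moment_le:
  fixes A :: "('n::finite \<times> 'd::finite) set"
  assumes "Kn \<le> CARD('n)" "Kd \<le> CARD('d)" "lam \<ge> 0"
  defines "P \<equiv> {S :: 'n set. card S = Kn} \<times> {T :: 'd set. card T = Kd}"
  shows "((\<Sum>x\<in>P. \<Prod>a\<in>A. block lam x $ fst a $ snd a) / real (card P))\<^sup>2 \<le>
    edge_weight (lam\<^sup>2) ((real Kn / real CARD('n))\<^sup>2) ((real Kd / real CARD('d))\<^sup>2) A"
proof -
  let ?p = "real Kn / real CARD('n)" and ?q = "real Kd / real CARD('d)"
  have prod: "(\<Prod>a\<in>A. block lam (S, T) $ fst a $ snd a) =
      lam ^ card A * (of_bool (fst ` A \<subseteq> S) * of_bool (snd ` A \<subseteq> T))" for S T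
  proof (cases "fst ` A \<subseteq> S \<and> snd ` A \<subseteq> T")
    case True
    then have "(\<Prod>a\<in>A. block lam (S, T) $ fst a $ snd a) = (\<Prod>a\<in>A. lam)"
      by (intro prod.cong) (auto simp: block_def)
    then show ?thesis using True by simp
  next
    case False
    then show ?thesis by (auto simp: block_def intro!: prod_zero)
  qed
  have cardP: "card P = (CARD('n) choose Kn) * (CARD('d) choose Kd)"
    unfolding P_def using n_subsets[of "UNIV :: 'n set" Kn] n_subsets[of "UNIV :: 'd set" Kd]
    by (simp add: card_cartesian_product)
  have pos: "real (card P) > 0"
    using assms(1,2) by (simp add: cardP)
  have "(\<Sum>x\<in>P. \<Prod>a\<in>A. block lam x $ fst a $ snd a) = lam ^ card A *
      ((\<Sum>S | card S = Kn. of_bool (fst ` A \<subseteq> S)) * (\<Sum>T | card T = Kd. of_bool (snd ` A \<subseteq> T)))"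
    unfolding P_def sum_product sum.cartesian_product sum_distrib_left[where r = "lam ^ card A"]
    by (intro sum.cong refl) (auto simp: prod)
  also have "\<dots> = lam ^ card A * (real (card {S. card S = Kn \<and> fst ` A \<subseteq> S}) *
      real (card {T. card T = Kd \<and> snd ` A \<subseteq> T}))"
    by (simp add: Int_def)
  finally have sum: "(\<Sum>x\<in>P. \<Prod>a\<in>A. block lam x $ fst a $ snd a) = \<dots>" .
  have "\<dots> \<le> lam ^ card A * ((?p ^ card (fst ` A) * real (CARD('n) choose Kn)) *
      (?q ^ card (snd ` A) * real (CARD('d) choose Kd)))"
    using assms(1-3) by (intro mult_left_mono mult_mono card_supersets_le) auto
  also have "\<dots> = (lam ^ card A * ?p ^ card (fst ` A) * ?q ^ card (snd ` A)) * real (card P)"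
    by (simp add: cardP)
  finally have "(\<Sum>x\<in>P. \<Prod>a\<in>A. block lam x $ fst a $ snd a) / real (card P) \<le>
      lam ^ card A * ?p ^ card (fst ` A) * ?q ^ card (snd ` A)"
    unfolding sum using pos by (simp add: pos_divide_le_eq)
  moreover have "0 \<le> (\<Sum>x\<in>P. \<Prod>a\<in>A. block lam x $ fst a $ snd a) / real (card P)"
    unfolding sum using assms(3) by simp
  ultimately have "((\<Sum>x\<in>P. \<Prod>a\<in>A. block lam x $ fst a $ snd a) / real (card P))\<^sup>2 \<le>
      (lam ^ card A * ?p ^ card (fst ` A) * ?q ^ card (snd ` A))\<^sup>2"
    by (rule power_mono)
  also have "\<dots> = edge_weight (lam\<^sup>2) (?p\<^sup>2) (?q\<^sup>2) A"
    unfolding edge_weight_def power_mult_distrib by (simp only: power_mult[symmetric] mult.commute)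
  finally show ?thesis .
qed

section \<open>Summing over bipartite graphs\<close>

text \<open>
  Cost of choosing the row (or column) of one more edge, when the vertices in \<open>R\<close> are already paid
  for.
\<close>

lemma sum_new_vertex_le:
  fixes R :: "'a::finite set" and p :: real
  assumes "card R \<le> e" "p \<ge> 0"
  shows "(\<Sum>i\<in>UNIV. if i \<in> R then 1 else p) \<le> real (Suc e) * max 1 (real CARD('a) * p)"
proof -
  have "(\<Sum>i\<in>UNIV. if i \<in> R then 1 else p) = real (card R) + real (card (- R)) * p"
    by (simp add: sum.If_cases)
  also have "\<dots> \<le> real e * max 1 (real CARD('a) * p) + max 1 (real CARD('a) * p)"
  proof (intro add_mono)
    show "real (card R) \<le> real e * max 1 (real CARD('a) * p)"
      using assms mult_mono[of "real (card R)" "real e" 1 "max 1 (real CARD('a) * p)"] by simp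
    have "real (card (- R)) * p \<le> real CARD('a) * p"
      using assms by (intro mult_right_mono) (auto intro: card_mono)
    then show "real (card (- R)) * p \<le> max 1 (real CARD('a) * p)" by simp
  qed
  finally show ?thesis by (simp add: algebra_simps)
qed

text \<open>
  Both sides come from counting pairs of a graph and a distinguished edge. Removing that edge leaves
  a graph \<open>B\<close> with \<open>e\<close> edges, hence with at most \<open>e\<close> rows and \<open>e\<close> columns. The sum over all ways to
  put an edge back factors into a choice of a row and a choice of a column, each contributing a factor
  \<open>e + 1\<close>; one of these two factors is cancelled by the \<open>e + 1\<close> choices of the distinguished edge.
\<close>

lemma sum_edge_weight_Suc_le:
  fixes l p q \<eta> :: real
  assumes nonneg: "l \<ge> 0" "p \<ge> 0" "q \<ge> 0"
    and \<eta>: "l * (max 1 (real CARD('n) * p) * max 1 (real CARD('d) * q)) \<le> \<eta>"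
  shows "(\<Sum>A :: ('n::finite \<times> 'd::finite) set | card A = Suc e. edge_weight l p q A) \<le>
    real (Suc e) * \<eta> * (\<Sum>B :: ('n \<times> 'd) set | card B = e. edge_weight l p q B)"
proof -
  let ?w = "edge_weight l p q :: ('n \<times> 'd) set \<Rightarrow> real"
  let ?r = "\<lambda>B :: ('n \<times> 'd) set. \<lambda>i. if i \<in> fst ` B then 1 else p"
  let ?c = "\<lambda>B :: ('n \<times> 'd) set. \<lambda>k. if k \<in> snd ` B then 1 else q"
  let ?m = "max 1 (real CARD('n) * p)" and ?m' = "max 1 (real CARD('d) * q)"
  have w: "?w B \<ge> 0" for B
    using nonneg by (simp add: edge_weight_def)
  have insert: "?w (insert a B) = ?w B * l * (?r B (fst a) * ?c B (snd a))" if "a \<notin> B" for a B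
    using that by (auto simp: edge_weight_def card_insert_if mult_ac)
  have product: "(\<Sum>a\<in>UNIV. g (fst a) * h (snd a)) = (\<Sum>i\<in>UNIV. g i) * (\<Sum>k\<in>UNIV. h k)"
    for g :: "'n \<Rightarrow> real" and h :: "'d \<Rightarrow> real"
    unfolding sum_product sum.cartesian_product by (simp add: case_prod_unfold)
  have ext: "(\<Sum>a\<in>- B. ?w (insert a B)) \<le> (real (Suc e))\<^sup>2 * \<eta> * ?w B" if B: "card B = e" for B
  proof -
    have le: "card (fst ` B) \<le> e" "card (snd ` B) \<le> e"
      using B card_image_le[of B fst] card_image_le[of B snd] by auto
    have "(\<Sum>a\<in>- B. ?w (insert a B)) =
        (\<Sum>a\<in>- B. ?w B * l * (?r B (fst a) * ?c B (snd a)))"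
      by (intro sum.cong refl insert) simp
    also have "\<dots> \<le> (\<Sum>a\<in>UNIV. ?w B * l * (?r B (fst a) * ?c B (snd a)))"
      using nonneg w by (intro sum_mono2) auto
    also have "\<dots> = ?w B * l * ((\<Sum>i\<in>UNIV. ?r B i) * (\<Sum>k\<in>UNIV. ?c B k))"
      unfolding sum_distrib_left[symmetric]
      using product[of "?r B" "?c B"] by simp
    also have "\<dots> \<le> ?w B * l * ((real (Suc e) * ?m) * (real (Suc e) * ?m'))"
      using nonneg w le by (intro mult_left_mono mult_mono sum_new_vertex_le) (auto intro!: sum_nonneg)
    also have "\<dots> = ?w B * (real (Suc e))\<^sup>2 * (l * (?m * ?m'))"
      by (simp add: power2_eq_square mult_ac)
    also have "\<dots> \<le> ?w B * (real (Suc e))\<^sup>2 * \<eta>"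
      using w \<eta> by (intro mult_left_mono) auto
    finally show ?thesis by (simp add: mult_ac)
  qed
  have "real (Suc e) * (\<Sum>A | card A = Suc e. ?w A) = (\<Sum>A | card A = Suc e. \<Sum>a\<in>A. ?w A)"
    by (simp add: sum_distrib_left)
  also have "\<dots> = (\<Sum>(A, a)\<in>(SIGMA A:{A. card A = Suc e}. A). ?w A)"
    by (rule sum.Sigma) auto
  also have "\<dots> = (\<Sum>(B, a)\<in>(SIGMA B:{B. card B = e}. - B). ?w (insert a B))"
    by (rule sum.reindex_bij_witness[of _ "\<lambda>(B, a). (insert a B, a)" "\<lambda>(A, a). (A - {a}, a)"])
      (auto simp: insert_absorb)
  also have "\<dots> = (\<Sum>B | card B = e. \<Sum>a\<in>- B. ?w (insert a B))"
    by (rule sum.Sigma[symmetric]) auto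
  also have "\<dots> \<le> (\<Sum>B | card B = e. (real (Suc e))\<^sup>2 * \<eta> * ?w B)"
    by (intro sum_mono ext) simp
  also have "\<dots> = real (Suc e) * (real (Suc e) * \<eta> * (\<Sum>B | card B = e. ?w B))"
    by (simp add: sum_distrib_left power2_eq_square mult_ac)
  finally show ?thesis
    by (subst (asm) mult_le_cancel_left_pos) auto
qed

text \<open>
  The recursion gives \<open>e! \<eta>\<^sup>e\<close>. Estimating every factor of \<open>e!\<close> by a bound \<open>N\<close> on the number of
  edges makes the bounds for different \<open>e\<close> a geometric sequence.
\<close>

lemma sum_edge_weight_le:
  fixes l p q \<eta> :: real
  assumes nonneg: "l \<ge> 0" "p \<ge> 0" "q \<ge> 0" "\<eta> \<ge> 0"
    and \<eta>: "l * (max 1 (real CARD('n) * p) * max 1 (real CARD('d) * q)) \<le> \<eta>"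
    and e: "e \<le> N"
  shows "(\<Sum>A :: ('n::finite \<times> 'd::finite) set | card A = e. edge_weight l p q A) \<le> (real N * \<eta>) ^ e"
  using e
proof (induction e)
  case 0
  have "{A :: ('n \<times> 'd) set. card A = 0} = {{}}" by auto
  then show ?case by (simp add: edge_weight_def)
next
  case (Suc e)
  have "(\<Sum>A :: ('n \<times> 'd) set | card A = Suc e. edge_weight l p q A) \<le>
      real (Suc e) * \<eta> * (\<Sum>B :: ('n \<times> 'd) set | card B = e. edge_weight l p q B)"
    by (intro sum_edge_weight_Suc_le assms)
  also have "\<dots> \<le> (real N * \<eta>) * (real N * \<eta>) ^ e"
    using Suc nonneg
    by (intro mult_mono mult_right_mono) (auto intro!: sum_nonneg simp: edge_weight_def)
  finally show ?case by simp
qed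

text \<open>The empty graph contributes the \<open>1\<close>, and the tail of the geometric series the rest.\<close>

lemma sum_edge_weight_low_degree_le:
  fixes l p q \<eta> D :: real
  assumes nonneg: "l \<ge> 0" "p \<ge> 0" "q \<ge> 0" "\<eta> \<ge> 0" "D \<ge> 0"
    and \<eta>: "l * (max 1 (real CARD('n) * p) * max 1 (real CARD('d) * q)) \<le> \<eta>"
    and D: "D * \<eta> \<le> 1 / 2"
  shows "(\<Sum>A :: ('n::finite \<times> 'd::finite) set | real (card A) \<le> D. edge_weight l p q A) \<le>
    1 + 2 * (D * \<eta>)"
proof -
  let ?w = "edge_weight l p q :: ('n \<times> 'd) set \<Rightarrow> real"
  define N where "N = nat \<lfloor>D\<rfloor>"
  have N: "real e \<le> D \<longleftrightarrow> e \<le> N" for e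
    unfolding N_def using nonneg by (simp add: le_nat_iff le_floor_iff)
  have ND: "real N * \<eta> \<le> D * \<eta>"
    using nonneg N[of N] by (intro mult_right_mono) auto
  have "(\<Sum>A | real (card A) \<le> D. ?w A) = (\<Sum>e\<le>N. \<Sum>A | A \<in> {A. card A \<le> N} \<and> card A = e. ?w A)"
    unfolding N by (rule sum.group[symmetric]) auto
  also have "\<dots> = (\<Sum>e\<le>N. \<Sum>A | card A = e. ?w A)"
    by (intro sum.cong) auto
  also have "\<dots> \<le> (\<Sum>e\<le>N. (D * \<eta>) ^ e)"
  proof (rule sum_mono)
    fix e assume "e \<in> {..N}"
    then have "(\<Sum>A | card A = e. ?w A) \<le> (real N * \<eta>) ^ e"
      using nonneg \<eta> by (intro sum_edge_weight_le) auto
    also have "\<dots> \<le> (D * \<eta>) ^ e"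
      using ND nonneg by (intro power_mono) auto
    finally show "(\<Sum>A | card A = e. ?w A) \<le> (D * \<eta>) ^ e" .
  qed
  also have "\<dots> \<le> suminf (\<lambda>e. (D * \<eta>) ^ e)"
    using D nonneg by (intro sum_le_suminf) (auto intro!: summable_geometric)
  also have "\<dots> = 1 / (1 - D * \<eta>)"
    using D nonneg by (intro suminf_geometric) auto
  also have "\<dots> \<le> 1 + 2 * (D * \<eta>)"
  proof -
    have "0 \<le> (D * \<eta>) * (1 - 2 * (D * \<eta>))"
      using D nonneg by (intro mult_nonneg_nonneg) auto
    then have "1 \<le> (1 + 2 * (D * \<eta>)) * (1 - D * \<eta>)"
      by (simp add: algebra_simps)
    then show ?thesis
      using D by (simp add: pos_divide_le_eq)
  qed
  finally show ?thesis .
qed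

section \<open>The minimax bound\<close>

theorem corollary3p3:
  fixes lam cbar :: real and Kn Kd :: nat
  assumes "CARD('n::finite) * CARD('d::finite) \<ge> 2"
    and "lam \<in> {0<..<1}"
    and "Kn \<in> {1..CARD('n)}" and "Kd \<in> {1..CARD('d)}"
    and "cbar \<ge> 10"
    and "Max {lam, lam * (real Kd / sqrt (real CARD('d))), lam * (real Kn / sqrt (real CARD('n))),
              lam * (real Kn * real Kd / sqrt (real (CARD('n) * CARD('d))))}
           \<le> 2 powr (- 2 - 2 * cbar) * ln (real (CARD('n) * CARD('d))) powr (- 1 / 2)"
  shows "(INF f \<in> polys_le (2 powr (2 * cbar) * ln (real (CARD('n) * CARD('d)))).
            SUP M \<in> planted lam Kn Kd \<union> {0 :: real ^ 'd ^ 'n}. sq_risk f M)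
         \<ge> 1 / 4 * (1 - 2 powr (- cbar))"
proof -
  let ?n = "real CARD('n)" and ?d = "real CARD('d)"
  let ?L = "ln (real (CARD('n) * CARD('d)))"
  let ?p = "(real Kn / ?n)\<^sup>2" and ?q = "(real Kd / ?d)\<^sup>2"
  define D where "D = 2 powr (2 * cbar) * ?L"
  define \<theta> where "\<theta> = 2 powr (- 2 - 2 * cbar) * ?L powr (- 1 / 2)"
  define P where "P = {S :: 'n set. card S = Kn} \<times> {T :: 'd set. card T = Kd}"
  have L: "?L > 0"
    using assms(1) by (intro ln_gt_zero) linarith
  have D0: "D \<ge> 0"
    using L by (simp add: D_def)
  have lam: "0 < lam" "lam < 1" using assms(2) by auto
  have bounds: "lam \<le> \<theta>" "lam * (real Kd / sqrt ?d) \<le> \<theta>" "lam * (real Kn / sqrt ?n) \<le> \<theta>"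
      "lam * (real Kn * real Kd / sqrt (?n * ?d)) \<le> \<theta>"
    using assms(6) unfolding \<theta>_def[symmetric] by (simp_all add: Max_le_iff)
  have eta: "lam\<^sup>2 * (max 1 (?n * ?p) * max 1 (?d * ?q)) \<le> \<theta>\<^sup>2"
  proof -
    have x: "?n * ?p = (real Kn / sqrt ?n)\<^sup>2" and y: "?d * ?q = (real Kd / sqrt ?d)\<^sup>2"
      by (simp_all add: power_divide power2_eq_square)
    have sq: "lam\<^sup>2 * z\<^sup>2 \<le> \<theta>\<^sup>2" if "lam * z \<le> \<theta>" "z \<ge> 0" for z
      using that lam power_mono[of "lam * z" \<theta> 2] by (simp add: power_mult_distrib)
    \<comment> \<open>Each of the four cases of the two maxima is the square of one of the four bounded quantities.\<close>
    have "real Kn * real Kd / sqrt (?n * ?d) = real Kn / sqrt ?n * (real Kd / sqrt ?d)"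
      by (simp add: real_sqrt_mult)
    then have "lam\<^sup>2 * ((real Kn / sqrt ?n)\<^sup>2 * (real Kd / sqrt ?d)\<^sup>2) \<le> \<theta>\<^sup>2"
      using sq[OF bounds(4)] by (simp only: power_mult_distrib) simp
    moreover have "lam\<^sup>2 * (real Kn / sqrt ?n)\<^sup>2 \<le> \<theta>\<^sup>2" "lam\<^sup>2 * (real Kd / sqrt ?d)\<^sup>2 \<le> \<theta>\<^sup>2"
        "lam\<^sup>2 * 1\<^sup>2 \<le> \<theta>\<^sup>2"
      using bounds by (intro sq; simp)+
    ultimately show ?thesis
      unfolding x y by (simp add: max_def)
  qed
  have D\<theta>: "D * \<theta>\<^sup>2 = 2 powr (- 4 - 2 * cbar)"
  proof -
    have "(?L powr (- 1 / 2))\<^sup>2 = 1 / ?L"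
      unfolding power2_eq_square powr_add[symmetric] using L by (simp add: powr_minus_divide)
    moreover have "(2 powr (- 2 - 2 * cbar) :: real)\<^sup>2 = 2 powr (- 4 - 4 * cbar)"
      by (simp add: powr_power)
    ultimately have "D * \<theta>\<^sup>2 = 2 powr (2 * cbar) * 2 powr (- 4 - 4 * cbar)"
      using L by (simp add: D_def \<theta>_def power_mult_distrib)
    also have "\<dots> = 2 powr (- 4 - 2 * cbar)"
      unfolding powr_add[symmetric] by (rule arg_cong) simp
    finally show ?thesis .
  qed
  also have "\<dots> \<le> 2 powr (- 1 - cbar)"
    using assms(5) by (intro powr_mono) auto
  finally have small: "2 * (D * \<theta>\<^sup>2) \<le> 2 powr (- cbar)"
    by (simp add: powr_diff powr_minus_divide)
  have half: "D * \<theta>\<^sup>2 \<le> 1 / 2"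
    using powr_mono[of "- 4 - 2 * cbar" "- 1" "2 :: real"] assms(5)
    unfolding D\<theta> by (simp add: powr_minus_divide)
  have P: "finite P" "P \<noteq> {}"
  proof -
    obtain S :: "'n set" and T :: "'d set" where "card S = Kn" "card T = Kd"
      using assms(3,4) obtain_subset_with_card_n[of Kn "UNIV :: 'n set"]
        obtain_subset_with_card_n[of Kd "UNIV :: 'd set"] by (metis atLeastAtMost_iff)
    then show "P \<noteq> {}" by (auto simp: P_def)
  qed simp
  have planted: "planted lam Kn Kd = block lam ` P"
    unfolding planted_def block_def P_def by auto
  have "1 / 4 * (1 - 2 powr (- cbar)) \<le> (SUP M\<in>planted lam Kn Kd \<union> {0 :: real ^ 'd ^ 'n}. sq_risk f M)"
    if f: "f \<in> polys_le D" for f :: "real ^ 'd ^ 'n \<Rightarrow> real"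
  proof -
    let ?R = "SUP M\<in>planted lam Kn Kd \<union> {0 :: real ^ 'd ^ 'n}. sq_risk f M"
    have nonzero: "block lam x \<noteq> (0 :: real ^ 'd ^ 'n)" if "x \<in> P" for x
    proof -
      obtain S T where x: "x = (S, T)" by fastforce
      then have "S \<noteq> {}" "T \<noteq> {}"
        using that assms(3,4) by (auto simp: P_def)
      then obtain i k where "i \<in> S" "k \<in> T" by auto
      then have "(block lam x :: real ^ 'd ^ 'n) $ i $ k = lam"
        by (simp add: x block_def)
      then show ?thesis using lam by auto
    qed
    have bounded: "\<bar>(block lam x :: real ^ 'd ^ 'n) $ i $ k\<bar> \<le> 1" for x i k
      using lam by (simp add: block_def split: prod.split)
    define V where "V = (\<Sum>A | real (card A) \<le> D.
      ((\<Sum>x\<in>P. \<Prod>a\<in>A. (block lam x :: real ^ 'd ^ 'n) $ fst a $ snd a) / real (card P))\<^sup>2)"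
    have "V \<le> (\<Sum>A :: ('n \<times> 'd) set | real (card A) \<le> D. edge_weight (lam\<^sup>2) ?p ?q A)"
      unfolding V_def P_def using assms(3,4) lam by (intro sum_mono average_block_moment_le) auto
    also have "\<dots> \<le> 1 + 2 * (D * \<theta>\<^sup>2)"
      using D0 eta half by (intro sum_edge_weight_low_degree_le) auto
    also have "\<dots> \<le> 1 + 2 powr (- cbar)"
      using small by (rule add_left_mono)
    finally have "3 / 4 - (1 + 2 powr (- cbar)) / 4 \<le> 3 / 4 - V / 4"
      by (intro diff_left_mono divide_right_mono) auto
    also have "\<dots> \<le> sq_risk f 0 + (\<Sum>x\<in>P. sq_risk f (block lam x)) / real (card P)"
      unfolding V_def by (intro average_risk_lower_bound f P bounded nonzero)
    also have "\<dots> \<le> ?R + ?R"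
    proof (intro add_mono)
      have upper: "sq_risk f M \<le> ?R" if "M \<in> planted lam Kn Kd \<union> {0}" for M
        using that by (rule cSUP_upper[OF _ bdd_above_sq_risk])
      show "sq_risk f 0 \<le> ?R" by (rule upper) simp
      have "(\<Sum>x\<in>P. sq_risk f (block lam x)) \<le> real (card P) * ?R"
        by (intro sum_bounded_above upper) (simp add: planted)
      then show "(\<Sum>x\<in>P. sq_risk f (block lam x)) / real (card P) \<le> ?R"
        using P by (simp add: divide_le_eq card_gt_0_iff mult.commute)
    qed
    finally have "3 / 4 - (1 + 2 powr (- cbar)) / 4 \<le> ?R + ?R" .
    moreover have "1 / 4 * (1 - \<delta>) \<le> R" if "3 / 4 - (1 + \<delta>) / 4 \<le> R + R" "0 \<le> \<delta>" for \<delta> R :: real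
      using that by (simp add: field_simps)
    ultimately show ?thesis by simp
  qed
  then show ?thesis
    unfolding D_def[symmetric]
    by (intro cINF_greatest polys_le_nonempty D0)
qed

end
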